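(* Let $t\in\{0,\dots,T-1\}$ and let $\mathfrak{O}_t$ be the set of one step values at time $t$ of some regular driver. Then there is a unique function $F(\omega,t,\cdot,\cdot)$ associated with $\mathfrak{O}_t$, that is, such that $F(\omega,t,Y_t,Z_t)$ is the value at time $t$, for given $Y_t$ and $Z_t$, of a driver generating $\mathfrak{O}_t$: if $F$ and $\tilde F$ are regular drivers both having $\mathfrak{O}_t$ as their set of one step values at time $t$, then $F(\omega,t,Y_t,Z_t)=\tilde F(\omega,t,Y_t,Z_t)$ $\mathbb{P}$-a.s. for all $Y_t\in L^\infty(\mathcal{F}_t;\mathbb{R}^K)$ and $Z_t\in L^\infty(\mathcal{F}_t;\mathbb{R}^{K\times N})$.
   Context: Setting. $N,K\ge 1$ are integers and $T\geq 1$ is a deterministic integer. $X=(X_t)_{0\le t\le T}$ is a process on a probability space $(\Omega,\mathcal{F},\mathbb{P})$ with values in the standard basis (column) vectors $\{e_1,\dots,e_N\}$ of $\mathbb{R}^N$, and $\mathcal{F}_t$ is the completion of the $\sigma$-algebra generated by $X_0,\dots,X_t$. Put $M_t:=X_t-E[X_t\mid\mathcal{F}_{t-1}]$ for $1\le t\le T$. All adapted processes $Y$ ($\mathbb{R}^K$-valued) and $Z$ ($\mathbb{R}^{K\times N}$-valued) have $Y_t,Z_t\in L^\infty(\mathcal{F}_t)$; random variables are identified when $\mathbb{P}$-a.s. equal. Driver. A driver is an adapted map $F:\Omega\times\{0,\dots,T\}\times\mathbb{R}^K\times\mathbb{R}^{K\times N}\to\mathbb{R}^K$ with $F(\omega,t,Y_t,Z_t)\in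 L^\infty(\mathcal{F}_t)$ for all $t$ and all $Y_t,Z_t\in L^\infty(\mathcal{F}_t)$. Equivalence. $Z^1\sim_M Z^2$ means $Z^1_uM_{u+1}=Z^2_uM_{u+1}$ $\mathbb{P}$-a.s. for all $u\in\{0,\dots,T-1\}$. A driver $F$ is called regular here if (a) for any adapted $Y$, $Z^1\sim_MZ^2$ implies $F(\omega,t,Y_t,Z^1_t)=F(\omega,t,Y_t,Z^2_t)$ $\mathbb{P}$-a.s. for all $t\in\{0,\dots,T-1\}$; and (b) for any adapted $Z$ and all $t\in\{0,\dots,T-1\}$, the map $Y_t\mapsto Y_t-F(\omega,t,Y_t,Z_t)$ is $\mathbb{P}$-a.s. a bijection of $\mathbb{R}^K$, up to equality $\mathbb{P}$-a.s. (i.e. it is a bijection of the set of $\mathbb{R}^K$-valued $\mathcal{F}_t$-measurable random variables, identified when a.s. equal, onto itself). One step values. For a regular driver $F$, the set of one step values at time $t$ is $\mathfrak{O}_t:=\{(Y_t,Y_{t+1})\}$, where $Y_{t+1}$ ranges over $L^\infty(\mathcal{F}_{t+1};\mathbb{R}^K)$ and $Y_t$ is the time $t$ solution to the BSDE with driver $F$ and terminal condition $Y_{t+1}$ at time $t+1$; that is, $Y_t$ is the a.s. unique element of $L^\infty(\mathcal{F}_t;\mathbb{R}^K)$ such that, for some $Z_t\in L^\infty(\mathcal{F}_t;\mathbb{R}^{K\times N})$, $Y_t-F(\omega,t,Y_t,Z_t)+Z_tM_{t+1}=Y_{t+1}$ $\mathbb{P}$-a.s. *)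

theory Defs
  imports "HOL-Probability.Probability"
begin

text \<open>
  Dimensions are index types: \<open>real ^ 'n\<close> is $R^N$ and \<open>real ^ 'n ^ 'k\<close> is $R^{K \times N}$,
  with \<open>N = CARD('n)\<close> and \<open>K = CARD('k)\<close>.  Random variables are represented by functions and
  identified through \<open>AE \<omega> in P\<close>.
\<close>

text \<open>
  The completion is taken with respect to all \<open>P\<close>-null sets. Since \<open>P\<close> itself need not be complete,
  these are the null sets of \<open>completion P\<close>, and \<open>filt P X t\<close> is a subalgebra of \<open>completion P\<close>.
\<close>

definition filt :: "'a measure \<Rightarrow> (nat \<Rightarrow> 'a \<Rightarrow> real ^ 'n) \<Rightarrow> nat \<Rightarrow> 'a measure" where
  "filt P X t = sigma (space P)
     ({X s -` A \<inter> space P | s A. s \<le> t \<and> A \<in> sets borel} \<union> null_sets (completion P))"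

definition Linf :: "'a measure \<Rightarrow> 'a measure \<Rightarrow> ('a \<Rightarrow> 'b::euclidean_space) set" where
  "Linf P G = {f. f \<in> borel_measurable G \<and> (\<exists>C::real. AE \<omega> in P. norm (f \<omega>) \<le> C)}"

definition adapted ::
  "'a measure \<Rightarrow> (nat \<Rightarrow> 'a \<Rightarrow> real ^ 'n) \<Rightarrow> nat \<Rightarrow> (nat \<Rightarrow> 'a \<Rightarrow> 'b::euclidean_space) \<Rightarrow> bool" where
  "adapted P X T Y \<longleftrightarrow> (\<forall>t\<le>T. Y t \<in> Linf P (filt P X t))"

text \<open>
  The conditional expectation is componentwise, the library one being real-valued.
  Only meaningful for \<open>t \<ge> 1\<close>, because of the truncated subtraction.
\<close>

definition mart_diff :: "'a measure \<Rightarrow> (nat \<Rightarrow> 'a \<Rightarrow> real ^ 'n) \<Rightarrow> nat \<Rightarrow> 'a \<Rightarrow> real ^ 'n" where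
  "mart_diff P X t \<omega> =
     X t \<omega> - (\<chi> i. real_cond_exp (completion P) (filt P X (t - 1)) (\<lambda>\<omega>'. X t \<omega>' $ i) \<omega>)"

definition equiv_M ::
  "'a measure \<Rightarrow> (nat \<Rightarrow> 'a \<Rightarrow> real ^ 'n) \<Rightarrow> nat \<Rightarrow>
   (nat \<Rightarrow> 'a \<Rightarrow> real ^ 'n ^ 'k) \<Rightarrow> (nat \<Rightarrow> 'a \<Rightarrow> real ^ 'n ^ 'k) \<Rightarrow> bool" where
  "equiv_M P X T Z1 Z2 \<longleftrightarrow>
     (\<forall>u<T. AE \<omega> in P. Z1 u \<omega> *v mart_diff P X (Suc u) \<omega> = Z2 u \<omega> *v mart_diff P X (Suc u) \<omega>)"

type_synonym ('a, 'k, 'n) driver_map =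
  "'a \<Rightarrow> nat \<Rightarrow> real ^ 'k \<Rightarrow> real ^ 'n ^ 'k \<Rightarrow> real ^ 'k"

definition driver ::
  "'a measure \<Rightarrow> (nat \<Rightarrow> 'a \<Rightarrow> real ^ 'n) \<Rightarrow> nat \<Rightarrow> ('a, 'k::finite, 'n::finite) driver_map \<Rightarrow> bool" where
  "driver P X T F \<longleftrightarrow>
     (\<forall>t\<le>T. (\<forall>y z. (\<lambda>\<omega>. F \<omega> t y z) \<in> borel_measurable (filt P X t)) \<and>
       (\<forall>Y \<in> Linf P (filt P X t). \<forall>Z \<in> Linf P (filt P X t).
          (\<lambda>\<omega>. F \<omega> t (Y \<omega>) (Z \<omega>)) \<in> Linf P (filt P X t)))"

text \<open>
  \<open>\<Phi>\<close> induces a well-defined bijection on the a.s.-equality classes of \<open>G\<close>-measurable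
  random variables.
\<close>

definition bij_mod_AE ::
  "'a measure \<Rightarrow> 'a measure \<Rightarrow> (('a \<Rightarrow> 'b::euclidean_space) \<Rightarrow> ('a \<Rightarrow> 'b)) \<Rightarrow> bool" where
  "bij_mod_AE P G \<Phi> \<longleftrightarrow>
     (\<forall>Y \<in> borel_measurable G. \<Phi> Y \<in> borel_measurable G) \<and>
     (\<forall>Y1 \<in> borel_measurable G. \<forall>Y2 \<in> borel_measurable G.
        (AE \<omega> in P. \<Phi> Y1 \<omega> = \<Phi> Y2 \<omega>) \<longleftrightarrow> (AE \<omega> in P. Y1 \<omega> = Y2 \<omega>)) \<and>
     (\<forall>V \<in> borel_measurable G. \<exists>Y \<in> borel_measurable G. AE \<omega> in P. \<Phi> Y \<omega> = V \<omega>)"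

definition regular_driver ::
  "'a measure \<Rightarrow> (nat \<Rightarrow> 'a \<Rightarrow> real ^ 'n) \<Rightarrow> nat \<Rightarrow> ('a, 'k::finite, 'n::finite) driver_map \<Rightarrow> bool" where
  "regular_driver P X T F \<longleftrightarrow> driver P X T F \<and>
     (\<forall>Y Z1 Z2. adapted P X T Y \<longrightarrow> adapted P X T Z1 \<longrightarrow> adapted P X T Z2 \<longrightarrow>
        equiv_M P X T Z1 Z2 \<longrightarrow>
        (\<forall>t<T. AE \<omega> in P. F \<omega> t (Y t \<omega>) (Z1 t \<omega>) = F \<omega> t (Y t \<omega>) (Z2 t \<omega>))) \<and>
     (\<forall>Z. adapted P X T Z \<longrightarrow>
        (\<forall>t<T. bij_mod_AE P (filt P X t) (\<lambda>Y \<omega>. Y \<omega> - F \<omega> t (Y \<omega>) (Z t \<omega>))))"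

definition solves_one_step ::
  "'a measure \<Rightarrow> (nat \<Rightarrow> 'a \<Rightarrow> real ^ 'n) \<Rightarrow> ('a, 'k::finite, 'n::finite) driver_map \<Rightarrow> nat \<Rightarrow>
   ('a \<Rightarrow> real ^ 'k) \<Rightarrow> ('a \<Rightarrow> real ^ 'k) \<Rightarrow> bool" where
  "solves_one_step P X F t Y Y' \<longleftrightarrow> Y \<in> Linf P (filt P X t) \<and>
     (\<exists>Z \<in> Linf P (filt P X t).
        AE \<omega> in P. Y \<omega> - F \<omega> t (Y \<omega>) (Z \<omega>) + Z \<omega> *v mart_diff P X (Suc t) \<omega> = Y' \<omega>)"

text \<open>
  Pairs of representatives. Membership of measurable representatives depends only on their classes
  modulo a.s. equality, so equality of these sets is equality of the sets of pairs of classes.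
\<close>

definition one_step_values ::
  "'a measure \<Rightarrow> (nat \<Rightarrow> 'a \<Rightarrow> real ^ 'n) \<Rightarrow> ('a, 'k::finite, 'n::finite) driver_map \<Rightarrow> nat \<Rightarrow>
   (('a \<Rightarrow> real ^ 'k) \<times> ('a \<Rightarrow> real ^ 'k)) set" where
  "one_step_values P X F t = {(Y, Y'). Y' \<in> Linf P (filt P X (Suc t)) \<and>
     solves_one_step P X F t Y Y' \<and>
     (\<forall>Y1. solves_one_step P X F t Y1 Y' \<longrightarrow> (AE \<omega> in P. Y1 \<omega> = Y \<omega>))}"

text \<open>Equality of maps \<open>F(\<omega>,t,\<cdot>,\<cdot>)\<close>, a.s. after inserting any $L^\infty(F_t)$ arguments.\<close>

definition eq_at ::
  "'a measure \<Rightarrow> (nat \<Rightarrow> 'a \<Rightarrow> real ^ 'n) \<Rightarrow> nat \<Rightarrow>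
   ('a \<Rightarrow> real ^ 'k \<Rightarrow> real ^ 'n ^ 'k \<Rightarrow> real ^ 'k) \<Rightarrow>
   ('a \<Rightarrow> real ^ 'k \<Rightarrow> real ^ 'n ^ 'k \<Rightarrow> real ^ 'k) \<Rightarrow> bool" where
  "eq_at P X t f g \<longleftrightarrow> (\<forall>Y \<in> Linf P (filt P X t). \<forall>Z \<in> Linf P (filt P X t).
     AE \<omega> in P. f \<omega> (Y \<omega>) (Z \<omega>) = g \<omega> (Y \<omega>) (Z \<omega>))"

definition associated_fun ::
  "'a measure \<Rightarrow> (nat \<Rightarrow> 'a \<Rightarrow> real ^ 'n) \<Rightarrow> nat \<Rightarrow> nat \<Rightarrow>
   (('a \<Rightarrow> real ^ 'k) \<times> ('a \<Rightarrow> real ^ 'k)) set \<Rightarrow>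
   ('a \<Rightarrow> real ^ 'k::finite \<Rightarrow> real ^ 'n::finite ^ 'k \<Rightarrow> real ^ 'k) \<Rightarrow> bool" where
  "associated_fun P X T t OS f \<longleftrightarrow>
     (\<exists>F. regular_driver P X T F \<and> one_step_values P X F t = OS \<and> eq_at P X t f (\<lambda>\<omega>. F \<omega> t))"

end

theory Submission
  imports Defs
begin

text \<open>
  Given \<open>Y\<close> and \<open>Z\<close>, put \<open>Y' = Y - F(Y, Z) + Z M\<close>. Conditioning on $F_t$ splits an equation
  \<open>V + Z M = V' + Z' M\<close> with $F_t$-measurable coefficients into \<open>V = V'\<close> and \<open>Z M = Z' M\<close>.
  With regularity this shows first that \<open>(Y, Y')\<close> is a one step value of \<open>F\<close>, hence of \<open>F'\<close>, and
  then, for the \<open>Z'\<close> by which \<open>F'\<close> generates it, that \<open>F(Y, Z) = F'(Y, Z') = F'(Y, Z)\<close>.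
\<close>

section \<open>The completed filtration\<close>

lemma space_filt [simp]: "space (filt P X t) = space P"
  by (simp add: filt_def space_measure_of_conv)

lemma sets_filt:
  "sets (filt P X t) = sigma_sets (space P)
     ({X s -` A \<inter> space P | s A. s \<le> t \<and> A \<in> sets borel} \<union> null_sets (completion P))"
proof -
  \<comment> \<open>\<open>sigma\<close> keeps its generators only if they all lie in
    \<open>Pow (space P)\<close>; otherwise it yields the trivial algebra.\<close>
  have "null_sets (completion P) \<subseteq> Pow (space P)"
    using sets.sets_into_space[of _ "completion P"] by auto
  then show ?thesis
    unfolding filt_def by (intro sets_measure_of) auto
qed

lemma sets_filt_mono: "s \<le> t \<Longrightarrow> sets (filt P X s) \<subseteq> sets (filt P X t)"
  unfolding sets_filt by (intro sigma_sets_mono') fastforce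

lemma subalgebra_filt:
  fixes X :: "nat \<Rightarrow> 'a \<Rightarrow> real ^ 'n::finite"
  assumes "\<And>s. s \<le> t \<Longrightarrow> X s \<in> borel_measurable P"
  shows "subalgebra (completion P) (filt P X t)"
proof -
  have "sets (filt P X t) \<subseteq> sets (completion P)"
    unfolding sets_filt space_completion[of P, symmetric]
  proof (rule sets.sigma_sets_subset, safe)
    fix s A assume "s \<le> t" "A \<in> sets (borel :: (real ^ 'n) measure)"
    then show "X s -` A \<inter> space (completion P) \<in> sets (completion P)"
      using measurable_sets[OF assms[OF \<open>s \<le> t\<close>] \<open>A \<in> sets borel\<close>]
      by (simp add: sets_completionI_sets)
  qed (simp add: null_setsD2)
  then show ?thesis
    by (simp add: subalgebra_def)
qed

lemma measurable_filt_process: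
  fixes X :: "nat \<Rightarrow> 'a \<Rightarrow> real ^ 'n::finite"
  assumes "s \<le> t"
  shows "X s \<in> borel_measurable (filt P X t)"
  using assms by (intro measurableI) (auto simp: sets_filt intro!: sigma_sets.Basic)

section \<open>Essentially bounded random variables\<close>

lemma Linf_measurable: "f \<in> Linf P G \<Longrightarrow> f \<in> borel_measurable G"
  by (simp add: Linf_def)

lemma Linf_const: "(\<lambda>_. c) \<in> Linf P G"
  by (auto simp: Linf_def)

lemma Linf_add:
  assumes "f \<in> Linf P G" "g \<in> Linf P G"
  shows "(\<lambda>\<omega>. f \<omega> + g \<omega>) \<in> Linf P G"
proof -
  obtain C D where "AE \<omega> in P. norm (f \<omega>) \<le> C" "AE \<omega> in P. norm (g \<omega>) \<le> D"
    using assms by (auto simp: Linf_def)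
  then have "AE \<omega> in P. norm (f \<omega> + g \<omega>) \<le> C + D"
    by eventually_elim (rule norm_triangle_mono)
  then show ?thesis
    using assms by (auto simp: Linf_def)
qed

lemma Linf_mult:
  fixes f g :: "'a \<Rightarrow> real"
  assumes "f \<in> Linf P G" "g \<in> Linf P G"
  shows "(\<lambda>\<omega>. f \<omega> * g \<omega>) \<in> Linf P G"
proof -
  obtain C D where "AE \<omega> in P. norm (f \<omega>) \<le> C" "AE \<omega> in P. norm (g \<omega>) \<le> D"
    using assms by (auto simp: Linf_def)
  then have "AE \<omega> in P. norm (f \<omega> * g \<omega>) \<le> C * D"
  proof eventually_elim
    case (elim \<omega>)
    \<comment> \<open>The sign of \<open>C\<close>, needed for monotonicity of the product, is read
      off at this \<omega> because \<open>C\<close> bounds a norm there.\<close>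
    moreover have "0 \<le> C"
      using elim(1) norm_ge_zero order_trans by blast
    ultimately show ?case
      by (simp add: abs_mult mult_mono)
  qed
  then show ?thesis
    using assms by (auto simp: Linf_def)
qed

lemma Linf_diff:
  assumes "f \<in> Linf P G" "g \<in> Linf P G"
  shows "(\<lambda>\<omega>. f \<omega> - g \<omega>) \<in> Linf P G"
proof -
  have "(\<lambda>\<omega>. - g \<omega>) \<in> Linf P G"
    using assms(2) by (simp add: Linf_def)
  from Linf_add[OF assms(1) this] show ?thesis by simp
qed

lemma Linf_sum:
  assumes "\<And>i. i \<in> I \<Longrightarrow> f i \<in> Linf P G"
  shows "(\<lambda>\<omega>. \<Sum>i\<in>I. f i \<omega>) \<in> Linf P G"
  using assms by (induction I rule: infinite_finite_induct) (auto simp: Linf_const Linf_add)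

lemma Linf_mono:
  assumes "f \<in> Linf P G" "space G = space H" "sets G \<subseteq> sets H"
  shows "f \<in> Linf P H"
  using assms measurable_mono[of borel borel G H] by (auto simp: Linf_def)

lemma Linf_nth:
  fixes f :: "'a \<Rightarrow> 'b::euclidean_space ^ 'k::finite"
  assumes "f \<in> Linf P G"
  shows "(\<lambda>\<omega>. f \<omega> $ i) \<in> Linf P G"
proof -
  have "(\<lambda>\<omega>. f \<omega> $ i) \<in> borel_measurable G"
    using Linf_measurable[OF assms]
    by (rule measurable_compose) (intro borel_measurable_continuous_onI continuous_intros)
  moreover obtain C where "AE \<omega> in P. norm (f \<omega>) \<le> C"
    using assms by (auto simp: Linf_def)
  then have "AE \<omega> in P. norm (f \<omega> $ i) \<le> C"
    by eventually_elim (rule order_trans[OF Finite_Cartesian_Product.norm_nth_le])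
  ultimately show ?thesis
    by (auto simp: Linf_def)
qed

lemma Linf_vecI:
  fixes f :: "'a \<Rightarrow> real ^ 'k::finite"
  assumes "\<And>i. (\<lambda>\<omega>. f \<omega> $ i) \<in> Linf P G"
  shows "f \<in> Linf P G"
proof -
  have "f \<in> borel_measurable G"
    unfolding borel_measurable_euclidean_space[of f] using Linf_measurable[OF assms]
    by (auto simp: Basis_vec_def inner_axis)
  moreover have "\<forall>i. \<exists>C. AE \<omega> in P. \<bar>f \<omega> $ i\<bar> \<le> C"
    using assms by (auto simp: Linf_def)
  then obtain C where C: "\<And>i. AE \<omega> in P. \<bar>f \<omega> $ i\<bar> \<le> C i"
    by metis
  then have "AE \<omega> in P. \<forall>i. \<bar>f \<omega> $ i\<bar> \<le> C i"
    by (simp add: AE_all_countable)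
  \<comment> \<open>The Euclidean norm is at most the l1 norm, so the sum of the component bounds
    serves as a bound.\<close>
  then have "AE \<omega> in P. norm (f \<omega>) \<le> sum C UNIV"
    by eventually_elim (rule order_trans[OF norm_le_l1_cart sum_mono], simp)
  ultimately show ?thesis
    by (auto simp: Linf_def)
qed

lemma Linf_matrix_vector_mult:
  fixes Z :: "'a \<Rightarrow> real ^ 'n::finite ^ 'k::finite"
  assumes "Z \<in> Linf P G" "f \<in> Linf P G"
  shows "(\<lambda>\<omega>. Z \<omega> *v f \<omega>) \<in> Linf P G"
  unfolding matrix_vector_mult_def using assms
  by (intro Linf_vecI) (simp add: Linf_sum Linf_mult Linf_nth)

section \<open>Conditioning and the martingale difference at a fixed time step\<close>

locale observed_process = prob_space P for P :: "'a measure" +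
  fixes X :: "nat \<Rightarrow> 'a \<Rightarrow> real ^ 'n::finite" and T t :: nat
  assumes measurable_process: "\<And>s. s \<le> T \<Longrightarrow> X s \<in> borel_measurable P"
    and basis_process: "\<And>s \<omega>. s \<le> T \<Longrightarrow> \<omega> \<in> space P \<Longrightarrow> \<exists>i. X s \<omega> = axis i 1"
    and t_less: "t < T"
begin

abbreviation "G \<equiv> filt P X t"
abbreviation "M \<equiv> mart_diff P X (Suc t)"
abbreviation "c j \<equiv> real_cond_exp (completion P) G (\<lambda>\<omega>. X (Suc t) \<omega> $ j)"

lemma subalgebra_completion: "s \<le> T \<Longrightarrow> subalgebra (completion P) (filt P X s)"
  using measurable_process by (intro subalgebra_filt) auto

sublocale completion: prob_space "completion P"
  by (rule prob_space_completion)

sublocale cond: finite_measure_subalgebra "completion P" G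
  using subalgebra_completion t_less by unfold_locales simp

lemma Linf_filt_Suc: "f \<in> Linf P G \<Longrightarrow> f \<in> Linf P (filt P X (Suc t))"
  by (erule Linf_mono) (simp_all add: sets_filt_mono)

text \<open>Integrals and conditional expectations are taken under \<open>completion P\<close>,
  since \<open>filt P X s\<close> may contain sets that are not in \<open>P\<close>. Almost sure
  bounds pass between the two measures by \<open>AE_completion_iff\<close>, and a bounded measurable
  function is integrable under a probability measure.\<close>

lemma Linf_integrable:
  fixes f :: "'a \<Rightarrow> real"
  assumes "f \<in> Linf P (filt P X s)" "s \<le> T"
  shows "integrable (completion P) f"
proof -
  obtain C where "AE \<omega> in completion P. norm (f \<omega>) \<le> C"
    using assms(1) by (auto simp: Linf_def AE_completion_iff)
  then show ?thesis
    using measurable_from_subalg[OF subalgebra_completion[OF assms(2)] Linf_measurable[OF assms(1)]]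
    by (rule completion.integrable_const_bound)
qed

lemma process_component_bounds:
  assumes "\<omega> \<in> space P"
  shows "0 \<le> X (Suc t) \<omega> $ j" "X (Suc t) \<omega> $ j \<le> 1"
  using basis_process[OF _ assms, of "Suc t"] t_less by (auto simp: axis_def)

lemma Linf_process: "(\<lambda>\<omega>. X (Suc t) \<omega> $ j) \<in> Linf P (filt P X (Suc t))"
proof (rule Linf_nth)
  have "norm (X (Suc t) \<omega>) \<le> 1" if "\<omega> \<in> space P" for \<omega>
    using basis_process[OF _ that, of "Suc t"] t_less by auto
  then show "X (Suc t) \<in> Linf P (filt P X (Suc t))"
    unfolding Linf_def using measurable_filt_process[of "Suc t" "Suc t" X P]
    by (auto intro!: exI[of _ 1])
qed

text \<open>Entries of basis vectors lie in [0,1], and conditional expectation preserves constant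
  lower and upper bounds almost surely.\<close>

lemma Linf_cond: "c j \<in> Linf P G"
proof -
  have int: "integrable (completion P) (\<lambda>\<omega>. X (Suc t) \<omega> $ j)"
    using Linf_integrable[OF Linf_process] t_less by simp
  have "AE \<omega> in completion P. c j \<omega> \<ge> 0"
    using process_component_bounds by (intro cond.real_cond_exp_ge_c int) auto
  moreover have "AE \<omega> in completion P. c j \<omega> \<le> 1"
    using process_component_bounds by (intro cond.real_cond_exp_le_c int) auto
  ultimately have "AE \<omega> in completion P. \<bar>c j \<omega>\<bar> \<le> 1"
    by eventually_elim simp
  then show ?thesis
    unfolding Linf_def AE_completion_iff by auto
qed

text \<open>At index \<open>Suc t\<close> the conditioning time in \<open>mart_diff\<close> is
  \<open>Suc t - 1 = t\<close>, so the subtracted components are exactly the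
  \<open>c j\<close>.\<close>

lemma Linf_mart_diff: "M \<in> Linf P (filt P X (Suc t))"
  unfolding mart_diff_def
  by (intro Linf_vecI) (simp add: Linf_diff Linf_process Linf_filt_Suc Linf_cond)

text \<open>Linearity, together with pulling the known factors \<open>z j\<close> out of the
  conditional expectation; boundedness makes every product integrable. As the index type is finite,
  one null set serves all \<open>j\<close>.\<close>

lemma cond_exp_process_sum:
  assumes "\<And>j. z j \<in> Linf P G"
  shows "AE \<omega> in completion P.
    real_cond_exp (completion P) G (\<lambda>\<omega>. \<Sum>j\<in>UNIV. z j \<omega> * X (Suc t) \<omega> $ j) \<omega> =
    (\<Sum>j\<in>UNIV. z j \<omega> * c j \<omega>)"
proof -
  have int: "integrable (completion P) (\<lambda>\<omega>. z j \<omega> * X (Suc t) \<omega> $ j)" for j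
    using Linf_integrable[OF Linf_mult[OF Linf_filt_Suc[OF assms] Linf_process]] t_less by simp
  have "AE \<omega> in completion P. \<forall>j. real_cond_exp (completion P) G
      (\<lambda>\<omega>. z j \<omega> * X (Suc t) \<omega> $ j) \<omega> = z j \<omega> * c j \<omega>"
    unfolding AE_all_countable
    using borel_measurable_integrable[OF Linf_integrable[OF Linf_process]] t_less
    by (intro allI cond.real_cond_exp_mult Linf_measurable[OF assms] int) simp
  with cond.real_cond_exp_sum[OF int] show ?thesis
    by eventually_elim simp
qed

text \<open>This is the martingale difference property: conditioning annihilates \<open>Z M\<close>.\<close>

lemma mart_diff_decomposition_zero:
  assumes W: "W \<in> Linf P G" and Z: "(Z :: 'a \<Rightarrow> real ^ 'n ^ 'k::finite) \<in> Linf P G"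
    and eq: "AE \<omega> in P. W \<omega> + Z \<omega> *v M \<omega> = 0"
  shows "AE \<omega> in P. W \<omega> = 0"
proof -
  have "AE \<omega> in completion P. W \<omega> $ i = 0" for i
  proof -
    let ?E = "real_cond_exp (completion P) G"
    let ?x = "\<lambda>\<omega>. \<Sum>j\<in>UNIV. Z \<omega> $ i $ j * X (Suc t) \<omega> $ j"
    let ?d = "\<lambda>\<omega>. \<Sum>j\<in>UNIV. Z \<omega> $ i $ j * c j \<omega>"
    have z: "(\<lambda>\<omega>. Z \<omega> $ i $ j) \<in> Linf P G" for j
      by (intro Linf_nth Z)
    have d: "?d \<in> Linf P G" "integrable (completion P) ?d"
      using t_less by (auto intro!: Linf_integrable[of _ t] Linf_sum Linf_mult z Linf_cond)
    have w: "(\<lambda>\<omega>. W \<omega> $ i) \<in> Linf P G" "integrable (completion P) (\<lambda>\<omega>. W \<omega> $ i)"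
      using t_less by (auto intro!: Linf_integrable[of _ t] Linf_nth W)
    have x: "integrable (completion P) ?x"
      using t_less
      by (intro Linf_integrable[of _ "Suc t"] Linf_sum Linf_mult Linf_filt_Suc[OF z] Linf_process)
        auto
    \<comment> \<open>Component \<open>i\<close> of \<open>Z M\<close> is \<open>?x - ?d\<close>,
      with \<open>?d\<close> the part already known at time \<open>t\<close>.\<close>
    have "AE \<omega> in completion P. W \<omega> $ i + ?x \<omega> = ?d \<omega>"
      unfolding AE_completion_iff using eq
    proof eventually_elim
      case (elim \<omega>)
      from arg_cong[OF this, of "\<lambda>v. v $ i"] show ?case
        by (simp add: matrix_vector_mult_def mart_diff_def right_diff_distrib sum_subtractf)
    qed
    \<comment> \<open>Conditioning fixes \<open>?d\<close> and component \<open>i\<close> of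
      \<open>W\<close>, both measurable at time \<open>t\<close>, and turns \<open>?x\<close> into
      \<open>?d\<close>. The equation becomes \<open>W $ i + ?d = ?d\<close>.\<close>
    then have "AE \<omega> in completion P. ?E (\<lambda>\<omega>. W \<omega> $ i + ?x \<omega>) \<omega> = ?E ?d \<omega>"
      using w d x by (intro cond.real_cond_exp_cong borel_measurable_integrable) auto
    with cond.real_cond_exp_add[OF w(2) x] cond_exp_process_sum[of "\<lambda>j \<omega>. Z \<omega> $ i $ j", OF z]
      cond.real_cond_exp_F_meas[OF w(2) Linf_measurable[OF w(1)]]
      cond.real_cond_exp_F_meas[OF d(2) Linf_measurable[OF d(1)]]
    show ?thesis
      by eventually_elim simp
  qed
  then have "AE \<omega> in P. \<forall>i. W \<omega> $ i = 0"
    by (simp add: AE_all_countable AE_completion_iff)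
  then show ?thesis
    by eventually_elim (simp add: vec_eq_iff)
qed

text \<open>The difference of the two decompositions is a decomposition of zero. The conclusion
  concerns the product with \<open>M\<close> rather than the coefficient itself, which is exactly
  what \<open>equiv_M\<close> compares.\<close>

lemma mart_diff_decomposition_unique:
  assumes "V \<in> Linf P G" "V' \<in> Linf P G"
    and "(Z :: 'a \<Rightarrow> real ^ 'n ^ 'k::finite) \<in> Linf P G" "Z' \<in> Linf P G"
    and eq: "AE \<omega> in P. V \<omega> + Z \<omega> *v M \<omega> = V' \<omega> + Z' \<omega> *v M \<omega>"
  shows "AE \<omega> in P. V \<omega> = V' \<omega>" "AE \<omega> in P. Z \<omega> *v M \<omega> = Z' \<omega> *v M \<omega>"
proof -
  have "AE \<omega> in P. (V \<omega> - V' \<omega>) + (Z \<omega> - Z' \<omega>) *v M \<omega> = 0"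
    using eq by eventually_elim (simp add: algebra_simps)
  from mart_diff_decomposition_zero[OF _ _ this]
  show "AE \<omega> in P. V \<omega> = V' \<omega>"
    using assms by (simp add: Linf_diff)
  with eq show "AE \<omega> in P. Z \<omega> *v M \<omega> = Z' \<omega> *v M \<omega>"
    by eventually_elim simp
qed

section \<open>Consequences of regularity at time \<open>t\<close> for a single driver\<close>

lemma adapted_single:
  "Y \<in> Linf P G \<Longrightarrow> adapted P X T (\<lambda>s. if s = t then Y else (\<lambda>_. 0))"
  by (simp add: adapted_def Linf_const)

context
  fixes F :: "('a, 'k::finite, 'n) driver_map"
  assumes F: "regular_driver P X T F"
begin

lemma driver_Linf:
  assumes "Y \<in> Linf P G" "Z \<in> Linf P G"
  shows "(\<lambda>\<omega>. F \<omega> t (Y \<omega>) (Z \<omega>)) \<in> Linf P G"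
  using F assms t_less by (auto simp: regular_driver_def driver_def)

lemma regular_driver_equiv:
  assumes "Y \<in> Linf P G" "Z \<in> Linf P G" "Z' \<in> Linf P G"
    and "AE \<omega> in P. Z \<omega> *v M \<omega> = Z' \<omega> *v M \<omega>"
  shows "AE \<omega> in P. F \<omega> t (Y \<omega>) (Z \<omega>) = F \<omega> t (Y \<omega>) (Z' \<omega>)"
proof -
  \<comment> \<open>Regularity speaks of whole adapted processes, so random variables at time
    \<open>t\<close> are extended by zero to all other times. There the equivalence reads 0 = 0, and
    only the hypothesis at \<open>t\<close> remains.\<close>
  let ?p = "\<lambda>V s. if s = t then V else (\<lambda>_. 0)"
  have "equiv_M P X T (?p Z) (?p Z')"
    using assms(4) by (simp add: equiv_M_def)
  then have "AE \<omega> in P. F \<omega> t (?p Y t \<omega>) (?p Z t \<omega>) = F \<omega> t (?p Y t \<omega>) (?p Z' t \<omega>)"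
    using F t_less adapted_single[OF assms(1)] adapted_single[OF assms(2)]
      adapted_single[OF assms(3)]
    unfolding regular_driver_def by blast
  then show ?thesis by simp
qed

lemma regular_driver_inj:
  assumes "Y \<in> Linf P G" "Y' \<in> Linf P G" "Z \<in> Linf P G"
    and "AE \<omega> in P. Y \<omega> - F \<omega> t (Y \<omega>) (Z \<omega>) = Y' \<omega> - F \<omega> t (Y' \<omega>) (Z \<omega>)"
  shows "AE \<omega> in P. Y \<omega> = Y' \<omega>"
proof -
  let ?p = "\<lambda>s. if s = t then Z else (\<lambda>_. 0)"
  have "bij_mod_AE P G (\<lambda>Y \<omega>. Y \<omega> - F \<omega> t (Y \<omega>) (?p t \<omega>))"
    using F t_less adapted_single[OF assms(3)] unfolding regular_driver_def by blast
  \<comment> \<open>Injectivity on almost sure classes of measurable functions, applied to bounded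
    representatives.\<close>
  then have "(AE \<omega> in P. Y \<omega> - F \<omega> t (Y \<omega>) (?p t \<omega>) = Y' \<omega> - F \<omega> t (Y' \<omega>) (?p t \<omega>))
      \<longleftrightarrow> (AE \<omega> in P. Y \<omega> = Y' \<omega>)"
    using Linf_measurable[OF assms(1)] Linf_measurable[OF assms(2)]
    unfolding bij_mod_AE_def by blast
  then show ?thesis
    using assms(4) by simp
qed

lemma one_step_value_generated:
  assumes Y: "Y \<in> Linf P G" and Z: "Z \<in> Linf P G"
  shows "(Y, \<lambda>\<omega>. Y \<omega> - F \<omega> t (Y \<omega>) (Z \<omega>) + Z \<omega> *v M \<omega>) \<in> one_step_values P X F t"
    (is "(Y, ?Y') \<in> _")
proof -
  have "?Y' \<in> Linf P (filt P X (Suc t))"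
    by (intro Linf_add Linf_filt_Suc[OF Linf_diff] Y Z driver_Linf
        Linf_matrix_vector_mult[OF Linf_filt_Suc] Linf_mart_diff)
  moreover have "solves_one_step P X F t Y ?Y'"
    using Y Z by (auto simp: solves_one_step_def)
  moreover have "AE \<omega> in P. Y1 \<omega> = Y \<omega>" if "solves_one_step P X F t Y1 ?Y'" for Y1
  proof -
    from that obtain Z1 where Y1: "Y1 \<in> Linf P G" and Z1: "Z1 \<in> Linf P G"
      and eq: "AE \<omega> in P. Y1 \<omega> - F \<omega> t (Y1 \<omega>) (Z1 \<omega>) + Z1 \<omega> *v M \<omega> = ?Y' \<omega>"
      by (auto simp: solves_one_step_def)
    \<comment> \<open>Injectivity compares \<open>Y1\<close> and \<open>Y\<close> under one common
      coefficient. The second half of \<open>split\<close> therefore serves to replace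
      \<open>Z1\<close> by \<open>Z\<close> inside the driver first.\<close>
    note split = mart_diff_decomposition_unique[OF Linf_diff[OF Y1 driver_Linf[OF Y1 Z1]]
        Linf_diff[OF Y driver_Linf[OF Y Z]] Z1 Z eq]
    from split(1) regular_driver_equiv[OF Y1 Z1 Z split(2)]
    have "AE \<omega> in P. Y1 \<omega> - F \<omega> t (Y1 \<omega>) (Z \<omega>) = Y \<omega> - F \<omega> t (Y \<omega>) (Z \<omega>)"
      by eventually_elim simp
    then show ?thesis
      by (rule regular_driver_inj[OF Y1 Y Z])
  qed
  ultimately show ?thesis
    by (simp add: one_step_values_def)
qed

end

section \<open>Two drivers with the same one step values\<close>

lemma regular_driver_determined:
  fixes F F' :: "('a, 'k::finite, 'n) driver_map"
  assumes F: "regular_driver P X T F" and F': "regular_driver P X T F'"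
    and same: "one_step_values P X F t = one_step_values P X F' t"
    and Y: "Y \<in> Linf P G" and Z: "Z \<in> Linf P G"
  shows "AE \<omega> in P. F \<omega> t (Y \<omega>) (Z \<omega>) = F' \<omega> t (Y \<omega>) (Z \<omega>)"
proof -
  \<comment> \<open>The pair generated by \<open>F\<close> from \<open>Y\<close> and
    \<open>Z\<close> is also a one step value of \<open>F'\<close>, with the same first entry
    \<open>Y\<close> but possibly another coefficient. Hence \<open>Y\<close> cancels in the first
    half of the splitting below.\<close>
  obtain Z' where Z': "Z' \<in> Linf P G" and eq: "AE \<omega> in P.
      Y \<omega> - F' \<omega> t (Y \<omega>) (Z' \<omega>) + Z' \<omega> *v M \<omega> = Y \<omega> - F \<omega> t (Y \<omega>) (Z \<omega>) + Z \<omega> *v M \<omega>"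
    using one_step_value_generated[OF F Y Z]
    unfolding same by (auto simp: one_step_values_def solves_one_step_def)
  note split = mart_diff_decomposition_unique[OF Linf_diff[OF Y driver_Linf[OF F' Y Z']]
      Linf_diff[OF Y driver_Linf[OF F Y Z]] Z' Z eq]
  from split(1) regular_driver_equiv[OF F' Y Z' Z split(2)] show ?thesis
    by eventually_elim simp
qed

end

theorem theorem5p1:
  fixes P :: "'a measure"
    and X :: "nat \<Rightarrow> 'a \<Rightarrow> real ^ 'n::finite"
    and T t :: nat
    and OS :: "(('a \<Rightarrow> real ^ 'k::finite) \<times> ('a \<Rightarrow> real ^ 'k)) set"
  assumes "prob_space P"
    and "T \<ge> 1"
    and "\<And>s. s \<le> T \<Longrightarrow> X s \<in> borel_measurable P"
    and "\<And>s \<omega>. s \<le> T \<Longrightarrow> \<omega> \<in> space P \<Longrightarrow> \<exists>i. X s \<omega> = axis i 1"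
    and "t < T"
    and "\<exists>F :: ('a, 'k, 'n) driver_map. regular_driver P X T F \<and> OS = one_step_values P X F t"
  shows "(\<exists>f. associated_fun P X T t OS f \<and>
              (\<forall>g. associated_fun P X T t OS g \<longrightarrow> eq_at P X t g f))
    \<and> (\<forall>F F' :: ('a, 'k, 'n) driver_map.
         regular_driver P X T F \<longrightarrow> regular_driver P X T F' \<longrightarrow>
         one_step_values P X F t = OS \<longrightarrow> one_step_values P X F' t = OS \<longrightarrow>
         (\<forall>Y \<in> Linf P (filt P X t). \<forall>Z \<in> Linf P (filt P X t).
            AE \<omega> in P. F \<omega> t (Y \<omega>) (Z \<omega>) = F' \<omega> t (Y \<omega>) (Z \<omega>)))"
proof -
  interpret observed_process P X T t
    by (intro observed_process.intro observed_process_axioms.intro assms)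
  have determined: "eq_at P X t (\<lambda>\<omega>. F \<omega> t) (\<lambda>\<omega>. F' \<omega> t)"
    if "regular_driver P X T F" "regular_driver P X T F'"
      "one_step_values P X F t = OS" "one_step_values P X F' t = OS"
    for F F' :: "('a, 'k, 'n) driver_map"
    using regular_driver_determined[OF that(1,2)] that(3,4) by (simp add: eq_at_def)
  obtain F :: "('a, 'k, 'n) driver_map"
    where F: "regular_driver P X T F" "one_step_values P X F t = OS"
    using assms(6) by auto
  have "associated_fun P X T t OS (\<lambda>\<omega>. F \<omega> t)"
    using F by (auto simp: associated_fun_def eq_at_def)
  \<comment> \<open>The driver \<open>F'\<close> behind \<open>g\<close> may differ from
    \<open>F\<close>, so \<open>g\<close> is compared with \<open>F\<close> through
    \<open>F'\<close>. The exceptional null sets may depend on \<open>Y\<close> and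
    \<open>Z\<close>, which are therefore fixed before the two equalities are chained.\<close>
  moreover have "eq_at P X t g (\<lambda>\<omega>. F \<omega> t)" if g: "associated_fun P X T t OS g" for g
  proof -
    obtain F' :: "('a, 'k, 'n) driver_map" where F': "regular_driver P X T F'" "one_step_values P X F' t = OS"
      and gF': "eq_at P X t g (\<lambda>\<omega>. F' \<omega> t)"
      using g by (auto simp: associated_fun_def)
    show ?thesis
      unfolding eq_at_def
    proof (intro ballI)
      fix Y :: "'a \<Rightarrow> real ^ 'k" and Z :: "'a \<Rightarrow> real ^ 'n ^ 'k"
      assume "Y \<in> Linf P (filt P X t)" "Z \<in> Linf P (filt P X t)"
      with gF' determined[OF F'(1) F(1) F'(2) F(2)]
      have "AE \<omega> in P. g \<omega> (Y \<omega>) (Z \<omega>) = F' \<omega> t (Y \<omega>) (Z \<omega>)"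
        "AE \<omega> in P. F' \<omega> t (Y \<omega>) (Z \<omega>) = F \<omega> t (Y \<omega>) (Z \<omega>)"
        by (auto simp: eq_at_def)
      then show "AE \<omega> in P. g \<omega> (Y \<omega>) (Z \<omega>) = F \<omega> t (Y \<omega>) (Z \<omega>)"
        by eventually_elim simp
    qed
  qed
  ultimately show ?thesis
    using determined unfolding eq_at_def by blast
qed

end
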